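(* Let $\alpha=(\alpha_1,\dots,\alpha_k)$ be a composition of $n$ and let $m\ge1$. For $i\ge1$ let $m_i(\alpha)$ be the number of parts of $\alpha$ equal to $i$. For $\sigma\in S_n$ written in one-line notation, let $\sigma^1,\dots,\sigma^k$ be the consecutive subwords of lengths $\alpha_1,\dots,\alpha_k$, and let $\max(\sigma^j)$ be the largest entry of $\sigma^j$. Then $$\Psi_{\alpha}(x_1,\dots,x_m)=\frac{\prod_{i=1}^n m_i(\alpha)!}{n!}\sum_{\sigma\in S_n}\ \sum_{\substack{1\le i_1\le\cdots\le i_k\le m\\ i_j=i_{j+1}\Rightarrow \max(\sigma^j)<\max(\sigma^{j+1})}} x_{i_1}^{\alpha_1}\cdots x_{i_k}^{\alpha_k}.$$
   Context: A composition of $n$ is a sequence of positive integers with sum $n$; $\ell(\alpha)$ is its number of parts. $\alpha\preccurlyeq\beta$ ($\alpha$ refines $\beta$, also written $\beta\succcurlyeq\alpha$) means $\beta$ is obtained from $\alpha$ by summing consecutive blocks of parts; $\alpha^{(i)}$ is the block of parts of $\alpha$ summing to $\beta_i$. The monomial quasisymmetric function is $M_\beta=\sum_{i_1<\cdots<i_r}x_{i_1}^{\beta_1}\cdots x_{i_r}^{\beta_r}$ for $\beta=(\beta_1,\dots,\beta_r)$. For a composition $\gamma$, $\pi(\gamma)=\prod_{i=1}^{\ell(\gamma)}(\gamma_1+\cdots+\gamma_i)$, and for $\alpha\preccurlyeq\beta$, $\pi(\alpha,\beta)=\prod_{i=1}^{\ell(\beta)}\pi(\alpha^{(i)})$. $z_\alpha=\prod_i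 i^{m_i(\alpha)}m_i(\alpha)!$. The type 1 quasisymmetric power sum is $\Psi_\alpha=z_\alpha\sum_{\beta\succcurlyeq\alpha}\frac{1}{\pi(\alpha,\beta)}M_\beta$, and $\Psi_\alpha(x_1,\dots,x_m)$ denotes its specialization with $x_i=0$ for $i>m$. *)

theory Defs
  imports Main "HOL-Library.Poly_Mapping" "HOL-Combinatorics.Permutations"
begin

definition composition :: "nat \<Rightarrow> nat list \<Rightarrow> bool" where
  "composition n \<alpha> \<longleftrightarrow> 0 \<notin> set \<alpha> \<and> sum_list \<alpha> = n"

(* For \<alpha> with positive parts there is at most one such bs for each \<beta>. *)
definition is_blocks :: "nat list \<Rightarrow> nat list \<Rightarrow> nat list list \<Rightarrow> bool" where
  "is_blocks \<alpha> \<beta> bs \<longleftrightarrow> concat bs = \<alpha> \<and> [] \<notin> set bs \<and> map sum_list bs = \<beta>"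

definition refines :: "nat list \<Rightarrow> nat list \<Rightarrow> bool"  (infix "\<preccurlyeq>" 50) where
  "\<alpha> \<preccurlyeq> \<beta> \<longleftrightarrow> (\<exists>bs. is_blocks \<alpha> \<beta> bs)"

definition blocks :: "nat list \<Rightarrow> nat list \<Rightarrow> nat list list" where
  "blocks \<alpha> \<beta> = (THE bs. is_blocks \<alpha> \<beta> bs)"

definition pi_comp :: "nat list \<Rightarrow> nat" where
  "pi_comp \<gamma> = (\<Prod>i=1..length \<gamma>. sum_list (take i \<gamma>))"

definition pi_ref :: "nat list \<Rightarrow> nat list \<Rightarrow> nat" where
  "pi_ref \<alpha> \<beta> = (\<Prod>i<length \<beta>. pi_comp (blocks \<alpha> \<beta> ! i))"

(* Parts larger than sum_list \<alpha> do not occur and would contribute factors 1. *)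
definition z_comp :: "nat list \<Rightarrow> nat" where
  "z_comp \<alpha> = (\<Prod>i=1..sum_list \<alpha>. i ^ count_list \<alpha> i * fact (count_list \<alpha> i))"

(* A formal power series in x_1, x_2, ... is given by its coefficients; an exponent vector e
   stands for the monomial \<Prod>i. x_i ^ lookup e i.  The polynomials among these are the
   finitely supported ones, for which Poly_Mapping supplies the ring structure. *)
type_synonym expvec = "nat \<Rightarrow>\<^sub>0 nat"
type_synonym 'a series = "expvec \<Rightarrow> 'a"
type_synonym 'a mpoly = "expvec \<Rightarrow>\<^sub>0 'a"

definition var :: "nat \<Rightarrow> 'a::comm_semiring_1 mpoly" where
  "var i = Poly_Mapping.single (Poly_Mapping.single i 1) 1"

definition const :: "'a \<Rightarrow> 'a::comm_semiring_1 mpoly" where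
  "const c = Poly_Mapping.single 0 c"

definition monom :: "nat list \<Rightarrow> nat list \<Rightarrow> 'a::comm_semiring_1 mpoly" where
  "monom is \<beta> = (\<Prod>j<length \<beta>. var (is ! j) ^ (\<beta> ! j))"

(* The coefficient of e in the infinite sum defining M_\<beta> is the number of strictly increasing
   index sequences whose term is the monomial e; this is finite because \<beta> has positive parts. *)
definition monomial_qsym :: "nat list \<Rightarrow> 'a::comm_semiring_1 series" where
  "monomial_qsym \<beta> e = of_nat (card {is. length is = length \<beta> \<and> 0 \<notin> set is \<and> sorted_wrt (<) is
     \<and> (monom is \<beta> :: 'a mpoly) = Poly_Mapping.single e 1})"

definition Psi :: "nat list \<Rightarrow> 'a::field_char_0 series" where
  "Psi \<alpha> e = of_nat (z_comp \<alpha>) *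
     (\<Sum>\<beta> | \<alpha> \<preccurlyeq> \<beta>. 1 / of_nat (pi_ref \<alpha> \<beta>) * monomial_qsym \<beta> e)"

(* Setting x_i = 0 for i > m kills exactly the monomials involving such a variable. *)
definition specialize :: "nat \<Rightarrow> 'a::zero series \<Rightarrow> 'a series" where
  "specialize m f e = (if Poly_Mapping.keys e \<subseteq> {1..m} then f e else 0)"

definition one_line :: "nat \<Rightarrow> (nat \<Rightarrow> nat) \<Rightarrow> nat list" where
  "one_line n \<sigma> = map \<sigma> [1..<Suc n]"

(* Indexed from 0: subword \<alpha> w j is the (j+1)-st consecutive subword. *)
definition subword :: "nat list \<Rightarrow> nat list \<Rightarrow> nat \<Rightarrow> nat list" where
  "subword \<alpha> w j = take (\<alpha> ! j) (drop (sum_list (take j \<alpha>)) w)"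

definition index_seqs :: "nat list \<Rightarrow> nat \<Rightarrow> nat list \<Rightarrow> nat list set" where
  "index_seqs \<alpha> m w = {is. length is = length \<alpha> \<and> set is \<subseteq> {1..m} \<and> sorted is \<and>
     (\<forall>j. Suc j < length \<alpha> \<longrightarrow> is ! j = is ! Suc j \<longrightarrow>
        Max (set (subword \<alpha> w j)) < Max (set (subword \<alpha> w (Suc j))))}"

end

theory Submission
  imports Defs "HOL-Combinatorics.Multiset_Permutations"
begin

text \<open>A weakly increasing index sequence is the same as a coarsening of \<open>\<alpha>\<close> (its runs of equal
  indices) together with a strictly increasing sequence. For a fixed index sequence, the
  condition on \<open>\<sigma>\<close> only concerns each run separately: the subword maxima have to increase along
  the run. For a uniformly random \<open>\<sigma>\<close>, the events that the maximum of the first \<open>r\<close> subwords of a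
  run lies in the \<open>r\<close>-th one are independent with probabilities \<open>\<alpha>\<^sub>r\<close> divided by the \<open>r\<close>-th partial
  sum. A block \<open>\<gamma>\<close> thus contributes the product of its parts divided by \<open>\<pi>(\<gamma>)\<close>, and the product
  of all parts of \<open>\<alpha>\<close> is what \<open>z\<^sub>\<alpha>\<close> has in addition to the factorials.\<close>

section \<open>Monomials and their exponent vectors\<close>

fun exponents :: "nat list \<Rightarrow> nat list \<Rightarrow> expvec" where
  "exponents (i # is) (b # \<beta>) = Poly_Mapping.single i b + exponents is \<beta>"
| "exponents _ _ = 0"

lemma var_power: "(var i ^ b :: 'a::comm_semiring_1 mpoly) = Poly_Mapping.single (Poly_Mapping.single i b) 1"
proof (induction b)
  case (Suc b)
  have "Poly_Mapping.single i 1 + Poly_Mapping.single i b = Poly_Mapping.single i (Suc b)"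
    by (simp flip: single_add)
  with Suc show ?case by (simp add: var_def mult_single)
qed simp

lemma monom_Cons:
  "(monom (i # is) (b # \<beta>) :: 'a::comm_semiring_1 mpoly) = var i ^ b * monom is \<beta>"
  unfolding monom_def by (simp add: prod.lessThan_Suc_shift del: prod.lessThan_Suc)

lemma monom_eq_single:
  assumes "length is = length \<beta>"
  shows "(monom is \<beta> :: 'a::comm_semiring_1 mpoly) = Poly_Mapping.single (exponents is \<beta>) 1"
  using assms
proof (induction "is" \<beta> rule: list_induct2)
  case Nil
  then show ?case by (simp add: monom_def)
next
  case (Cons i "is" b \<beta>)
  then show ?case by (simp add: monom_Cons var_power mult_single)
qed

lemma monom_eq_single_iff:
  assumes "length is = length \<beta>"
  shows "(monom is \<beta> :: 'a::comm_semiring_1 mpoly) = Poly_Mapping.single e 1 \<longleftrightarrow> exponents is \<beta> = e"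
  by (metis assms lookup_single_eq lookup_single_not_eq monom_eq_single zero_neq_one)

lemma exponents_append:
  "length is = length \<beta> \<Longrightarrow>
    exponents (is @ js) (\<beta> @ \<gamma>) = exponents is \<beta> + exponents js \<gamma>"
  by (induction "is" \<beta> rule: list_induct2) (simp_all add: add.assoc)

lemma exponents_replicate:
  "exponents (replicate (length b) j) b = Poly_Mapping.single j (sum_list b)"
  by (induction b) (simp_all add: single_add)

text \<open>Positive exponents in \<open>nat\<close> cannot cancel, so every index used stays
  visible in the support. This turns a condition on the variables of \<open>e\<close> into one on
  index sequences.\<close>

lemma keys_exponents:
  assumes "length is = length \<beta>" "0 \<notin> set \<beta>"
  shows "Poly_Mapping.keys (exponents is \<beta>) = set is"
  using assms
proof (induction "is" \<beta> rule: list_induct2)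
  case (Cons i "is" b \<beta>)
  have "Poly_Mapping.keys (Poly_Mapping.single i b + f) = insert i (Poly_Mapping.keys f)" for f
    using Cons.prems by (auto simp: in_keys_iff lookup_add lookup_single when_def split: if_splits)
  with Cons show ?case by simp
qed simp

section \<open>Words with increasing block maxima\<close>

text \<open>The part of the condition in \<open>index_seqs\<close> that involves the word; what
  remains is independent of it and becomes \<open>weak_seqs\<close>.\<close>

definition increasing_maxima :: "nat list \<Rightarrow> nat list \<Rightarrow> nat list \<Rightarrow> bool" where
  "increasing_maxima \<alpha> is w \<longleftrightarrow> (\<forall>j. Suc j < length \<alpha> \<longrightarrow> is ! j = is ! Suc j \<longrightarrow>
     Max (set (subword \<alpha> w j)) < Max (set (subword \<alpha> w (Suc j))))"

lemma increasing_maxima_short: "length \<alpha> \<le> 1 \<Longrightarrow> increasing_maxima \<alpha> is w"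
  by (auto simp: increasing_maxima_def)

lemma increasing_maxima_Cons2:
  "increasing_maxima (a # b # \<alpha>) (i # j # is) w \<longleftrightarrow>
     (i = j \<longrightarrow> Max (set (take a w)) < Max (set (take b (drop a w)))) \<and>
     increasing_maxima (b # \<alpha>) (j # is) (drop a w)"
proof -
  have *: "subword (a # \<gamma>) w (Suc k) = subword \<gamma> (drop a w) k" for \<gamma> k
    by (simp add: subword_def add.commute)
  \<comment> \<open>Position 0 compares the first two subwords; the shifted positions are those of
    the word with its first subword removed.\<close>
  have all: "(\<forall>k. P k) \<longleftrightarrow> P 0 \<and> (\<forall>k. P (Suc k))" for P :: "nat \<Rightarrow> bool"
    by (metis not0_implies_Suc)
  show ?thesis
    unfolding increasing_maxima_def by (subst all, simp only: *) (simp add: subword_def)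
qed

text \<open>The first subword enters only through its maximum. Its length may change as well, which
  is what merging two blocks requires.\<close>

lemma increasing_maxima_Cons_cong:
  assumes "Max (set (take a w)) = Max (set (take a' w'))" "drop a w = drop a' w'"
    and "length is = length \<alpha>"
  shows "increasing_maxima (a # \<alpha>) (i # is) w \<longleftrightarrow> increasing_maxima (a' # \<alpha>) (i # is) w'"
proof (cases \<alpha>)
  case (Cons b \<alpha>')
  then obtain j js where "is = j # js" using assms(3) by (cases "is") auto
  with Cons assms show ?thesis by (simp add: increasing_maxima_Cons2)
qed (simp add: increasing_maxima_short)

text \<open>The second maximum exceeds the first exactly when the maximum of the joint block lies in
  its second half, positions \<open>a\<close> to \<open>a + b - 1\<close> counted from 0. In that
  case the joint block and the second block have the same maximum and are followed by the same
  letters.\<close>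

lemma merge_maxima:
  assumes "distinct w" "a + b \<le> length w" "0 < a" "0 < b" "length is = length \<alpha>"
  shows "increasing_maxima (a # b # \<alpha>) (i # i # is) w \<longleftrightarrow>
    increasing_maxima ((a + b) # \<alpha>) (i # is) w \<and>
    (\<exists>q\<in>{a..<a + b}. w ! q = Max (set (take (a + b) w)))"
proof -
  define U V where "U = set (take a w)" and "V = set (take b (drop a w))"
  have fin: "finite U" "finite V" by (simp_all add: U_def V_def)
  have ne: "U \<noteq> {}" "V \<noteq> {}" using assms by (auto simp: U_def V_def)
  have UV: "set (take (a + b) w) = U \<union> V" by (simp add: take_add U_def V_def)
  have "distinct (take (a + b) w)" using assms by simp
  then have disj: "U \<inter> V = {}" by (auto simp: take_add U_def V_def)
  have V_nth: "V = (!) w ` {a..<a + b}"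
  proof -
    have "V = (\<lambda>k. take b (drop a w) ! k) ` {..<b}"
      using assms(2) unfolding V_def by (auto simp: in_set_conv_nth simp del: nth_take)
    also have "\<dots> = (\<lambda>k. w ! (a + k)) ` {..<b}" using assms(2) by (intro image_cong) auto
    also have "\<dots> = (!) w ` ((+) a ` {..<b})" by (simp add: image_image)
    also have "(+) a ` {..<b} = {a..<a + b}"
      by (simp add: lessThan_atLeast0 add.commute)
    finally show ?thesis .
  qed
  have max: "Max (U \<union> V) = max (Max U) (Max V)" using fin ne by (simp add: Max_Un)
  have neq: "Max U \<noteq> Max V" using Max_in[OF fin(1) ne(1)] Max_in[OF fin(2) ne(2)] disj by auto
  have iff: "Max U < Max V \<longleftrightarrow> Max (U \<union> V) \<in> V"
  proof
    assume "Max U < Max V"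
    then show "Max (U \<union> V) \<in> V" using Max_in[OF fin(2) ne(2)] by (simp add: max)
  next
    assume "Max (U \<union> V) \<in> V"
    then have "Max U \<noteq> Max (U \<union> V)" using Max_in[OF fin(1) ne(1)] disj by auto
    then show "Max U < Max V" by (simp add: max max_def split: if_splits)
  qed
  have "increasing_maxima ((a + b) # \<alpha>) (i # is) w \<longleftrightarrow> increasing_maxima (b # \<alpha>) (i # is) (drop a w)"
    if "Max U < Max V"
  proof (rule increasing_maxima_Cons_cong)
    show "Max (set (take (a + b) w)) = Max (set (take b (drop a w)))"
      using that unfolding UV max V_def[symmetric] by simp
  qed (use assms in \<open>simp_all add: add.commute\<close>)
  moreover have "Max U < Max V \<longleftrightarrow> (\<exists>q\<in>{a..<a + b}. w ! q = Max (set (take (a + b) w)))"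
  proof -
    have "x \<in> V \<longleftrightarrow> (\<exists>q\<in>{a..<a + b}. w ! q = x)" for x unfolding V_nth by auto
    then show ?thesis by (simp only: iff UV)
  qed
  ultimately show ?thesis
    by (auto simp: increasing_maxima_Cons2 U_def V_def)
qed

text \<open>Exchanging letters within the first block affects neither its maximum nor the other blocks.\<close>

lemma card_max_at_position:
  fixes A :: "nat set" and i :: nat
  assumes "finite A" "N \<le> card A" "q < N" "length is = length \<alpha>"
  defines "T \<equiv> {w \<in> permutations_of_set A. increasing_maxima (N # \<alpha>) (i # is) w}"
  shows "card {w \<in> T. w ! q = Max (set (take N w))} = card {w \<in> T. w ! 0 = Max (set (take N w))}"
proof -
  \<comment> \<open>Transposing positions \<open>0\<close> and \<open>q\<close> is an involution
    that carries a maximum at one position to the other.\<close>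
  define f :: "nat list \<Rightarrow> nat list" where "f w = w[q := w ! 0, 0 := w ! q]" for w
  have len: "N \<le> length w" if "w \<in> T" for w
    using that assms(1,2) by (auto simp: T_def permutations_of_set_def distinct_card)
  have set_f: "set (take N (f w)) = set (take N w)" if "w \<in> T" for w
  proof -
    have "take N (f w) = (take N w)[q := take N w ! 0, 0 := take N w ! q]"
      using assms(3) by (simp add: f_def take_update_swap)
    also have "set \<dots> = set (take N w)"
      using len[OF that] assms(3) by (intro set_swap) auto
    finally show ?thesis .
  qed
  have f_T: "f w \<in> T" if "w \<in> T" for w
  proof -
    have "set (f w) = set w" "distinct (f w) = distinct w"
      unfolding f_def using len[OF that] assms(3) by (intro set_swap distinct_swap; linarith)+
    moreover have "drop N (f w) = drop N w"
      using assms(3) by (simp add: f_def)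
    then have "increasing_maxima (N # \<alpha>) (i # is) (f w) \<longleftrightarrow> increasing_maxima (N # \<alpha>) (i # is) w"
      using set_f[OF that] assms(4) by (intro increasing_maxima_Cons_cong) auto
    ultimately show ?thesis using that by (simp add: T_def permutations_of_set_def)
  qed
  have nth_f: "f w ! 0 = w ! q" "f w ! q = w ! 0" if "w \<in> T" for w
  proof -
    have "0 < length w" "q < length w" using len[OF that] assms(3) by auto
    then show "f w ! 0 = w ! q" "f w ! q = w ! 0" by (simp_all add: f_def nth_list_update)
  qed
  have f_f: "f (f w) = w" if "w \<in> T" for w
  proof -
    have "0 < length w" "q < length w" using len[OF that] assms(3) by auto
    then show ?thesis by (intro nth_equalityI) (auto simp: f_def nth_list_update)
  qed
  have "bij_betw f {w \<in> T. w ! q = Max (set (take N w))} {w \<in> T. w ! 0 = Max (set (take N w))}"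
    by (rule bij_betw_byWitness[where f' = f]) (auto simp: f_f f_T nth_f set_f)
  then show ?thesis by (rule bij_betw_same_card)
qed

text \<open>Classify the words of the merged problem by the position of the maximum of the first
  \<open>a + b\<close> letters. The \<open>a + b\<close> classes are equally large, and the words of
  the unmerged problem form \<open>b\<close> of them.\<close>

lemma card_merge_maxima:
  fixes A :: "nat set"
  assumes "finite A" "a + b \<le> card A" "0 < a" "0 < b" "length is = length \<alpha>"
  shows "(a + b) * card {w \<in> permutations_of_set A. increasing_maxima (a # b # \<alpha>) (i # i # is) w} =
    b * card {w \<in> permutations_of_set A. increasing_maxima ((a + b) # \<alpha>) (i # is) w}"
proof -
  define T where "T = {w \<in> permutations_of_set A. increasing_maxima ((a + b) # \<alpha>) (i # is) w}"
  define Tq where "Tq q = {w \<in> T. w ! q = Max (set (take (a + b) w))}" for q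
  have w: "distinct w" "a + b \<le> length w" if "w \<in> permutations_of_set A" for w
    using that assms(1,2) by (auto simp: permutations_of_set_def distinct_card)
  have finT: "finite T" by (simp add: T_def)
  have card_Tq: "card (Tq q) = card (Tq 0)" if "q < a + b" for q
    unfolding Tq_def T_def using assms that by (intro card_max_at_position) auto
  \<comment> \<open>Needed for two choices of \<open>Q\<close>: all positions of the merged block,
    and those of its second half.\<close>
  have union: "card (\<Union>q\<in>Q. Tq q) = card Q * card (Tq 0)" if "Q \<subseteq> {..<a + b}" for Q
  proof -
    have "card (\<Union>q\<in>Q. Tq q) = (\<Sum>q\<in>Q. card (Tq q))"
    proof (rule card_UN_disjoint)
      show "finite Q" using that finite_subset by blast
      show "\<forall>q\<in>Q. finite (Tq q)" using finT by (simp add: Tq_def)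
      show "\<forall>q\<in>Q. \<forall>r\<in>Q. q \<noteq> r \<longrightarrow> Tq q \<inter> Tq r = {}"
      proof (intro ballI impI)
        fix q r assume qr: "q \<in> Q" "r \<in> Q" "q \<noteq> r"
        have False if "w \<in> Tq q" "w \<in> Tq r" for w
        proof -
          have "w \<in> permutations_of_set A" "w ! q = w ! r" using that by (auto simp: Tq_def T_def)
          moreover have "q < length w" "r < length w"
            using qr \<open>Q \<subseteq> _\<close> w(2)[OF calculation(1)] by auto
          ultimately show False using w(1) qr(3) nth_eq_iff_index_eq by blast
        qed
        then show "Tq q \<inter> Tq r = {}" by auto
      qed
    qed
    also have "\<dots> = (\<Sum>q\<in>Q. card (Tq 0))" using card_Tq that by (intro sum.cong) auto
    also have "\<dots> = card Q * card (Tq 0)" by simp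
    finally show ?thesis .
  qed
  have "T = (\<Union>q\<in>{..<a + b}. Tq q)"
  proof -
    have "\<exists>q<a + b. w ! q = Max (set (take (a + b) w))" if "w \<in> T" for w
    proof -
      have "a + b \<le> length w" using that w by (simp add: T_def)
      then have "Max (set (take (a + b) w)) \<in> set (take (a + b) w)"
        using assms(3) by (intro Max_in) auto
      with \<open>a + b \<le> length w\<close> show ?thesis by (auto simp: in_set_conv_nth)
    qed
    then show ?thesis by (auto simp: Tq_def)
  qed
  then have "card T = (a + b) * card (Tq 0)" using union[of "{..<a + b}"] by simp
  moreover have "{w \<in> permutations_of_set A. increasing_maxima (a # b # \<alpha>) (i # i # is) w} =
      (\<Union>q\<in>{a..<a + b}. Tq q)"
    (is "?M = _")
  proof (rule set_eqI)
    fix w show "w \<in> ?M \<longleftrightarrow> w \<in> (\<Union>q\<in>{a..<a + b}. Tq q)"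
    proof (cases "w \<in> permutations_of_set A")
      case True
      then show ?thesis
        using merge_maxima[OF w assms(3-), of w i] unfolding Tq_def T_def by blast
    qed (simp add: Tq_def T_def)
  qed
  then have "card {w \<in> permutations_of_set A. increasing_maxima (a # b # \<alpha>) (i # i # is) w} =
      b * card (Tq 0)"
    using union[of "{a..<a + b}"] by (simp add: subset_eq)
  ultimately show ?thesis by (simp add: T_def)
qed

text \<open>Cut each word after \<open>a\<close> letters. Every prefix leaves a set of the same
  size, hence \<open>c\<close> continuations, and the number of prefixes is a falling factorial. The
  factorials are cross-multiplied to stay within \<open>nat\<close>.\<close>

lemma card_drop_permutations:
  fixes A :: "'b set"
  assumes "finite A" "a \<le> card A"
    and cnt: "\<And>B. B \<subseteq> A \<Longrightarrow> card B = card A - a \<Longrightarrow> card {v \<in> permutations_of_set B. P v} = c"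
  shows "fact (card A - a) * card {w \<in> permutations_of_set A. P (drop a w)} = fact (card A) * c"
proof -
  define U where "U = {u. length u = a \<and> distinct u \<and> set u \<subseteq> A}"
  define S where "S = Sigma U (\<lambda>u. {v \<in> permutations_of_set (A - set u). P v})"
  have "bij_betw (\<lambda>w. (take a w, drop a w)) {w \<in> permutations_of_set A. P (drop a w)} S"
  proof (rule bij_betw_byWitness[where f' = "\<lambda>(u, v). u @ v"])
    show "(\<lambda>w. (take a w, drop a w)) ` {w \<in> permutations_of_set A. P (drop a w)} \<subseteq> S"
    proof clarify
      fix w assume w: "w \<in> permutations_of_set A" "P (drop a w)"
      then have "distinct (take a w @ drop a w)" "set (take a w @ drop a w) = A"
        by (simp_all add: permutations_of_set_def)
      then have "distinct (take a w)" "distinct (drop a w)" "set (take a w) \<subseteq> A"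
          "set (drop a w) = A - set (take a w)"
        by (force simp only: distinct_append set_append)+
      moreover have "length w = card A"
        using w(1) by (auto simp: permutations_of_set_def distinct_card)
      ultimately show "(take a w, drop a w) \<in> S"
        using w assms(2) by (auto simp: S_def U_def permutations_of_set_def)
    qed
  qed (auto simp: S_def U_def permutations_of_set_def)
  then have "card {w \<in> permutations_of_set A. P (drop a w)} = card S"
    by (rule bij_betw_same_card)
  also have "\<dots> = (\<Sum>u\<in>U. card {v \<in> permutations_of_set (A - set u). P v})"
    unfolding S_def
    by (rule card_SigmaI) (use assms(1) in \<open>auto simp: U_def intro: finite_subset[OF _ finite_lists_length_eq[of A a]]\<close>)
  also have "\<dots> = (\<Sum>u\<in>U. c)"
    using assms(1)
    by (intro sum.cong refl cnt) (auto simp: U_def card_Diff_subset distinct_card)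
  finally have "card {w \<in> permutations_of_set A. P (drop a w)} = card U * c" by simp
  moreover have "card U = \<Prod>{card A - a + 1 .. card A}"
    unfolding U_def using assms by (intro card_lists_distinct_length_eq) auto
  moreover have "fact (card A - a) * \<Prod>{card A - a + 1 .. card A} = (fact (card A) :: nat)"
    using fact_eq_fact_times[of "card A - a" "card A"] by simp
  ultimately show ?thesis by (metis mult.assoc)
qed

text \<open>The probability that a random word has increasing maxima. Merging the first two parts
  whenever their indices agree makes the first part the partial sum of its run.\<close>

fun chain_weight :: "nat list \<Rightarrow> nat list \<Rightarrow> 'a::field_char_0" where
  "chain_weight (a # b # \<alpha>) (i # j # is) =
     (if i = j then of_nat b / of_nat (a + b) * chain_weight ((a + b) # \<alpha>) (j # is)
      else chain_weight (b # \<alpha>) (j # is))"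
| "chain_weight _ _ = 1"

text \<open>Induction along the recursion of \<open>chain_weight\<close>: equal leading indices are
  handled by merging two blocks, different ones by discarding the first block, whose letters are
  unconstrained.\<close>

lemma card_increasing_maxima:
  fixes A :: "nat set"
  assumes "finite A" "card A = sum_list \<alpha>" "length is = length \<alpha>" "0 \<notin> set \<alpha>"
  shows "of_nat (card {w \<in> permutations_of_set A. increasing_maxima \<alpha> is w}) =
    fact (card A) * (chain_weight \<alpha> is :: 'a::field_char_0)"
  using assms
proof (induction \<alpha> "is" arbitrary: A rule: chain_weight.induct)
  case (1 a b \<alpha> i j "is")
  have A: "finite A" "a + b \<le> card A" "0 < a" "0 < b" "length is = length \<alpha>"
    using "1.prems" by auto
  let ?c = "card {w \<in> permutations_of_set A. increasing_maxima (a # b # \<alpha>) (i # j # is) w}"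
  show ?case
  proof (cases "i = j")
    case True
    let ?d = "card {w \<in> permutations_of_set A. increasing_maxima ((a + b) # \<alpha>) (j # is) w}"
    have "of_nat ?d = fact (card A) * (chain_weight ((a + b) # \<alpha>) (j # is) :: 'a)"
      by (rule "1.IH"(1)[OF True]) (use "1.prems" in auto)
    moreover have "(of_nat (a + b) :: 'a) * of_nat ?c = of_nat b * of_nat ?d"
      using card_merge_maxima[OF A, of j] True by (simp only: flip: of_nat_mult)
    moreover have "(of_nat (a + b) :: 'a) \<noteq> 0" using A by (simp del: of_nat_add)
    ultimately show ?thesis using True by (simp add: field_simps del: of_nat_add)
  next
    case False
    let ?N = "\<lambda>B. card {v \<in> permutations_of_set B. increasing_maxima (b # \<alpha>) (j # is) v}"
    have count: "of_nat (?N B) = fact (card A - a) * (chain_weight (b # \<alpha>) (j # is) :: 'a)"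
      if "B \<subseteq> A" "card B = card A - a" for B
      using "1.IH"(2)[OF False, of B] that "1.prems" by (auto intro: finite_subset)
    \<comment> \<open>The induction hypothesis gives the count for the remaining letters only as a
      field element. A sample set \<open>C\<close> names it as a natural number, and characteristic
      0 transfers the equality for every other \<open>B\<close> back to \<open>nat\<close>.\<close>
    obtain C where C: "C \<subseteq> A" "card C = card A - a"
      using obtain_subset_with_card_n[of "card A - a" A] by auto
    define c where "c = ?N C"
    have c_eq: "of_nat c = fact (card A - a) * (chain_weight (b # \<alpha>) (j # is) :: 'a)"
      unfolding c_def by (rule count[OF C])
    have c: "?N B = c" if "B \<subseteq> A" "card B = card A - a" for B
      using count[OF that] unfolding c_eq[symmetric] by (simp only: of_nat_eq_iff)
    have "fact (card A - a) * card {w \<in> permutations_of_set A.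
        increasing_maxima (b # \<alpha>) (j # is) (drop a w)} = fact (card A) * c"
      by (rule card_drop_permutations) (use A c in auto)
    then have "fact (card A - a) * ?c = fact (card A) * c"
      using False by (simp add: increasing_maxima_Cons2)
    then have "(of_nat (fact (card A - a)) :: 'a) * of_nat ?c = of_nat (fact (card A)) * of_nat c"
      by (simp only: flip: of_nat_mult)
    then show ?thesis using False by (simp add: c_eq)
  qed
\<comment> \<open>With equal lengths, the remaining clauses mean at most one part: the condition is
  vacuous and all words count.\<close>
qed (use increasing_maxima_short in auto)

section \<open>Permutations and their one-line words\<close>

lemma one_line_bij:
  "bij_betw (one_line n) {\<sigma>. \<sigma> permutes {1..n}} (permutations_of_set {1..n})"
proof -
  let ?P = "{\<sigma>. \<sigma> permutes {1..n}}"
  have inj: "inj_on (one_line n) ?P"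
  proof (rule inj_onI)
    fix \<sigma> \<tau> assume perm: "\<sigma> \<in> ?P" "\<tau> \<in> ?P" and eq: "one_line n \<sigma> = one_line n \<tau>"
    show "\<sigma> = \<tau>"
    proof
      fix x
      have "\<sigma> x = \<tau> x" if "x \<in> {1..n}"
        using eq that by (auto simp: one_line_def simp del: upt_Suc)
      then show "\<sigma> x = \<tau> x" using perm by (metis mem_Collect_eq permutes_not_in)
    qed
  qed
  have "one_line n ` ?P \<subseteq> permutations_of_set {1..n}"
  proof clarify
    fix \<sigma> assume "\<sigma> permutes {1..n}"
    moreover have "{1..<Suc n} = {1..n}" by auto
    ultimately show "one_line n \<sigma> \<in> permutations_of_set {1..n}"
      by (auto simp: one_line_def permutations_of_set_def distinct_map permutes_image
          permutes_inj_on simp del: upt_Suc)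
  qed
  \<comment> \<open>Surjectivity follows by counting: both sides have \<open>n!\<close>
    elements.\<close>
  moreover have "card (one_line n ` ?P) = card (permutations_of_set {1..n})"
    by (simp add: card_image[OF inj] card_permutations del: One_nat_def)
  ultimately show ?thesis
    using inj by (simp add: bij_betw_def card_subset_eq)
qed

section \<open>Weakly increasing sequences and coarsenings\<close>

text \<open>Encodes the coarsenings of \<open>\<alpha>\<close> by their blocks, so that no definite
  description is involved.\<close>

definition block_splits :: "nat list \<Rightarrow> nat list list set" where
  "block_splits \<alpha> = {bs. concat bs = \<alpha> \<and> [] \<notin> set bs}"

definition increasing_seqs :: "nat \<Rightarrow> nat \<Rightarrow> nat list set" where
  "increasing_seqs m r = {js. length js = r \<and> set js \<subseteq> {1..m} \<and> sorted_wrt (<) js}"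

definition weak_seqs :: "nat \<Rightarrow> nat \<Rightarrow> nat list set" where
  "weak_seqs m r = {is. length is = r \<and> set is \<subseteq> {1..m} \<and> sorted is}"

text \<open>Rebuilds a weakly increasing sequence from its runs: the blocks supply the run lengths,
  the second list the values.\<close>

fun spread :: "nat list list \<Rightarrow> nat list \<Rightarrow> nat list" where
  "spread (b # bs) (j # js) = replicate (length b) j @ spread bs js"
| "spread _ _ = []"

lemma finite_increasing_seqs: "finite (increasing_seqs m r)"
  by (rule finite_subset[OF _ finite_lists_length_eq[of "{1..m}" r]])
    (auto simp: increasing_seqs_def)

lemma finite_weak_seqs: "finite (weak_seqs m r)"
  by (rule finite_subset[OF _ finite_lists_length_eq[of "{1..m}" r]])
    (auto simp: weak_seqs_def)

lemma finite_block_splits: "finite (block_splits \<alpha>)"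
proof (rule finite_subset)
  let ?L = "{b. set b \<subseteq> set \<alpha> \<and> length b \<le> length \<alpha>}"
  have len: "length bs \<le> length (concat bs)" if "[] \<notin> set bs" for bs :: "nat list list"
    using that
  proof (induction bs)
    case (Cons b bs)
    then have "Suc 0 \<le> length b" by (cases b) auto
    with Cons show ?case by simp
  qed simp
  have mem: "length b \<le> length (concat bs)" if "b \<in> set bs" for b :: "nat list" and bs
    using that by (induction bs) auto
  show "block_splits \<alpha> \<subseteq> {bs. set bs \<subseteq> ?L \<and> length bs \<le> length \<alpha>}"
    using len mem by (fastforce simp: block_splits_def)
  show "finite {bs. set bs \<subseteq> ?L \<and> length bs \<le> length \<alpha>}"
    by (intro finite_lists_length_le) simp
qed

lemma length_spread: "length bs = length js \<Longrightarrow> length (spread bs js) = length (concat bs)"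
  by (induction bs js rule: list_induct2) auto

lemma set_spread:
  "length bs = length js \<Longrightarrow> [] \<notin> set bs \<Longrightarrow> set (spread bs js) = set js"
  by (induction bs js rule: list_induct2) auto

lemma sorted_spread:
  "length bs = length js \<Longrightarrow> [] \<notin> set bs \<Longrightarrow> sorted_wrt (<) js \<Longrightarrow> sorted (spread bs js)"
  by (induction bs js rule: list_induct2)
    (auto simp: sorted_append set_spread less_imp_le)

text \<open>Equal indices along a block add up its exponents, so a term of the theorem's sum becomes
  a term of the monomial quasisymmetric function of the coarsening.\<close>

lemma exponents_spread:
  "length bs = length js \<Longrightarrow>
    exponents (spread bs js) (concat bs) = exponents js (map sum_list bs)"
  by (induction bs js rule: list_induct2) (simp_all add: exponents_append exponents_replicate)

text \<open>The head of a strictly increasing list does not recur, so the first run has exactly the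
  length of the first block; peel it off and repeat.\<close>

lemma spread_inj:
  assumes "length bs = length js" "length bs' = length js"
    and "[] \<notin> set bs" "[] \<notin> set bs'" "sorted_wrt (<) js"
    and "concat bs = concat bs'" "spread bs js = spread bs' js"
  shows "bs = bs'"
  using assms
proof (induction bs js arbitrary: bs' rule: list_induct2)
  case (Cons b bs j js)
  then obtain b' bs'' where bs': "bs' = b' # bs''" by (cases bs') auto
  have sets: "set (spread bs js) = set js" "set (spread bs'' js) = set js"
    using Cons.hyps Cons.prems bs' by (auto intro!: set_spread)
  have "j \<notin> set js" using Cons.prems by auto
  then have tw: "takeWhile (\<lambda>x. x = j) (replicate k j @ xs) = replicate k j"
    if "set xs = set js" for k xs
    using that by (subst takeWhile_append2) (auto intro!: takeWhile_eq_Nil_iff[THEN iffD2] dest: hd_in_set)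
  have "length b = length b'"
    using arg_cong[OF Cons.prems(6), of "\<lambda>x. length (takeWhile (\<lambda>x. x = j) x)"]
    unfolding bs' spread.simps by (simp only: tw sets length_replicate)
  with Cons.prems bs' Cons.IH[of bs''] show ?case by auto
qed simp

text \<open>Build the runs from the right: a new index either equals the head of \<open>js\<close>,
  and its part joins the first block, or is smaller and opens a new block.\<close>

lemma spread_surj:
  assumes "length \<alpha> = length is" "sorted is"
  shows "\<exists>bs js. concat bs = \<alpha> \<and> [] \<notin> set bs \<and> length bs = length js \<and>
    sorted_wrt (<) js \<and> spread bs js = is"
  using assms
proof (induction \<alpha> "is" rule: list_induct2)
  case Nil
  have "concat [] = [] \<and> [] \<notin> set [] \<and> length [] = length [] \<and>
    sorted_wrt (<) [] \<and> spread [] [] = []" by simp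
  then show ?case by blast
next
  case (Cons a \<alpha> i "is")
  then obtain bs js where IH: "concat bs = \<alpha>" "[] \<notin> set bs" "length bs = length js"
    "sorted_wrt (<) js" "spread bs js = is" by auto
  have le: "\<forall>j\<in>set js. i \<le> j" using Cons.prems IH set_spread[of bs js] by simp
  show ?case
  proof (cases "i \<in> set js")
    case True
    then obtain j js' where js: "js = j # js'" by (cases js) auto
    then obtain b bs' where bs: "bs = b # bs'" using IH by (cases bs) auto
    \<comment> \<open>By sortedness \<open>i\<close> bounds all of \<open>js\<close> from below, and
      \<open>j\<close> is the least entry of \<open>js\<close>.\<close>
    have "j = i" using True le IH(4) js by force
    then have "concat ((a # b) # bs') = a # \<alpha> \<and> [] \<notin> set ((a # b) # bs') \<and>
      length ((a # b) # bs') = length js \<and> sorted_wrt (<) js \<and> spread ((a # b) # bs') js = i # is"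
      using IH js bs by auto
    then show ?thesis by blast
  next
    case False
    then have "concat ([a] # bs) = a # \<alpha> \<and> [] \<notin> set ([a] # bs) \<and>
      length ([a] # bs) = length (i # js) \<and> sorted_wrt (<) (i # js) \<and>
      spread ([a] # bs) (i # js) = i # is"
      using IH le by (auto simp: order.strict_iff_order)
    then show ?thesis by blast
  qed
qed

lemma spread_bij:
  "bij_betw (\<lambda>(bs, js). spread bs js)
    (SIGMA bs:block_splits \<alpha>. increasing_seqs m (length bs)) (weak_seqs m (length \<alpha>))"
  unfolding bij_betw_def
proof
  show "inj_on (\<lambda>(bs, js). spread bs js) (SIGMA bs:block_splits \<alpha>. increasing_seqs m (length bs))"
  proof (rule inj_onI, clarify)
    fix bs js bs' js'
    assume *: "bs \<in> block_splits \<alpha>" "js \<in> increasing_seqs m (length bs)"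
      "bs' \<in> block_splits \<alpha>" "js' \<in> increasing_seqs m (length bs')" "spread bs js = spread bs' js'"
    \<comment> \<open>The set of values determines a strictly increasing list; once the lists agree,
      \<open>spread_inj\<close> recovers the blocks.\<close>
    then have "set js = set js'"
      using set_spread[of bs js] set_spread[of bs' js']
      by (auto simp: block_splits_def increasing_seqs_def)
    then have "js = js'" using * by (auto simp: increasing_seqs_def intro: strict_sorted_equal)
    moreover have "bs = bs'"
      using * \<open>js = js'\<close> by (intro spread_inj[of bs js bs']) (auto simp: block_splits_def increasing_seqs_def)
    ultimately show "bs = bs' \<and> js = js'" by simp
  qed
  show "(\<lambda>(bs, js). spread bs js) ` (SIGMA bs:block_splits \<alpha>. increasing_seqs m (length bs)) =
    weak_seqs m (length \<alpha>)"
  proof (intro equalityI subsetI)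
    fix "is" assume "is \<in> weak_seqs m (length \<alpha>)"
    then have is': "length \<alpha> = length is" "sorted is" "set is \<subseteq> {1..m}" by (auto simp: weak_seqs_def)
    then obtain bs js where *: "concat bs = \<alpha>" "[] \<notin> set bs" "length bs = length js"
      "sorted_wrt (<) js" "spread bs js = is" using spread_surj by blast
    then have "bs \<in> block_splits \<alpha>" "js \<in> increasing_seqs m (length bs)"
      using is'(3) set_spread[of bs js] by (auto simp: block_splits_def increasing_seqs_def)
    with *(5) show "is \<in> (\<lambda>(bs, js). spread bs js) `
        (SIGMA bs:block_splits \<alpha>. increasing_seqs m (length bs))"
      by force
  next
    fix "is" assume "is \<in> (\<lambda>(bs, js). spread bs js) `
        (SIGMA bs:block_splits \<alpha>. increasing_seqs m (length bs))"
    then obtain bs js where *: "bs \<in> block_splits \<alpha>" "js \<in> increasing_seqs m (length bs)"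
      and is_eq: "is = spread bs js" by auto
    then have "length bs = length js" "[] \<notin> set bs" "concat bs = \<alpha>" "sorted_wrt (<) js"
      "set js \<subseteq> {1..m}"
      by (auto simp: block_splits_def increasing_seqs_def)
    then show "is \<in> weak_seqs m (length \<alpha>)"
      using length_spread[of bs js] set_spread[of bs js] sorted_spread[of bs js]
      by (simp add: weak_seqs_def is_eq)
  qed
qed

section \<open>Coarsenings as splittings into blocks\<close>

text \<open>Of two candidate first blocks one is a prefix of the other. Their sums agree and the
  parts are positive, so the surplus is empty.\<close>

lemma is_blocks_unique:
  fixes bs bs' :: "nat list list"
  assumes "0 \<notin> set (concat bs)" "[] \<notin> set bs" "[] \<notin> set bs'"
    and "concat bs = concat bs'" "map sum_list bs = map sum_list bs'"
  shows "bs = bs'"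
  using assms
proof (induction bs arbitrary: bs')
  case (Cons b bs)
  then obtain b' bs'' where bs': "bs' = b' # bs''" by (cases bs') auto
  have eq: "b @ concat bs = b' @ concat bs''" "sum_list b = sum_list b'"
    using Cons.prems bs' by auto
  have pos: "us = []" if "sum_list us = 0" "0 \<notin> set us" for us :: "nat list"
    using that by (cases us) auto
  have nz: "0 \<notin> set b" "0 \<notin> set b'"
    using Cons.prems bs' by (auto simp del: set_concat) (metis Un_iff eq(1) set_append)
  have "b = b'"
  proof -
    obtain us :: "nat list" where "b = b' @ us \<or> b' = b @ us"
      using eq(1) by (auto simp: append_eq_append_conv2)
    then show ?thesis using eq(2) nz pos[of us] by auto
  qed
  moreover have "bs = bs''"
  proof (rule Cons.IH)
    show "0 \<notin> set (concat bs)" using Cons.prems(1) by simp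
    show "concat bs = concat bs''" using eq(1) \<open>b = b'\<close> by simp
  qed (use Cons.prems bs' in simp_all)
  ultimately show ?case by (simp add: bs')
qed simp

lemma blocks_eq:
  assumes "0 \<notin> set \<alpha>" "bs \<in> block_splits \<alpha>"
  shows "blocks \<alpha> (map sum_list bs) = bs"
  unfolding blocks_def
proof (rule the_equality)
  show "is_blocks \<alpha> (map sum_list bs) bs" using assms by (simp add: is_blocks_def block_splits_def)
  fix cs assume "is_blocks \<alpha> (map sum_list bs) cs"
  then show "cs = bs"
    using assms by (intro is_blocks_unique) (auto simp: is_blocks_def block_splits_def)
qed

text \<open>Allows the sum defining \<open>Psi\<close> to run over block splittings; injectivity
  holds because \<open>blocks\<close> is a left inverse.\<close>

lemma coarsenings_bij:
  assumes "0 \<notin> set \<alpha>"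
  shows "bij_betw (map sum_list) (block_splits \<alpha>) {\<beta>. \<alpha> \<preccurlyeq> \<beta>}"
  unfolding bij_betw_def
proof
  show "inj_on (map sum_list) (block_splits \<alpha>)"
    by (rule inj_onI) (metis assms blocks_eq)
  show "map sum_list ` block_splits \<alpha> = {\<beta>. \<alpha> \<preccurlyeq> \<beta>}"
    by (auto simp: refines_def is_blocks_def block_splits_def)
qed

lemma pi_ref_eq:
  assumes "0 \<notin> set \<alpha>" "bs \<in> block_splits \<alpha>"
  shows "pi_ref \<alpha> (map sum_list bs) = prod_list (map pi_comp bs)"
  unfolding pi_ref_def blocks_eq[OF assms]
  by (simp add: prod.list_conv_set_nth lessThan_atLeast0)

section \<open>The weight of a block\<close>

lemma pi_comp_Cons: "pi_comp (x # b) = (\<Prod>i\<le>length b. x + sum_list (take i b))"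
  unfolding pi_comp_def
  by (simp add: prod.atLeast_Suc_atMost_Suc_shift atMost_atLeast0 del: prod.cl_ivl_Suc)

text \<open>Merging the first two parts removes the partial sum \<open>x\<close> and keeps all
  others, in step with the recursion of \<open>chain_weight\<close>.\<close>

lemma pi_comp_Cons2: "pi_comp (x # y # b) = x * pi_comp ((x + y) # b)"
  unfolding pi_comp_Cons by (simp add: prod.atMost_Suc_shift add.assoc del: prod.atMost_Suc)

lemma pi_comp_pos: "0 < x \<Longrightarrow> 0 < pi_comp (x # b)"
  by (simp add: pi_comp_Cons)

text \<open>The head \<open>x\<close> accumulates the partial sums, so it is generalized in the
  induction. Each merge contributes a part over the new partial sum; the initial \<open>x\<close> is
  added to numerator and denominator alike. Since \<open>j\<close> does not occur in
  \<open>is\<close>, the weight starts afresh after the block.\<close>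

lemma chain_weight_block:
  assumes "0 < x" "j \<notin> set is" "length is = length \<alpha>"
  shows "(chain_weight (x # b @ \<alpha>) (j # replicate (length b) j @ is) :: 'a::field_char_0) =
    of_nat (prod_list (x # b)) / of_nat (pi_comp (x # b)) * chain_weight \<alpha> is"
  using assms
proof (induction b arbitrary: x)
  case Nil
  have "pi_comp [x] = x" by (simp add: pi_comp_Cons)
  moreover have "chain_weight (x # \<alpha>) (j # is) = (chain_weight \<alpha> is :: 'a)"
    using Nil.prems by (cases \<alpha>; cases "is") auto
  ultimately show ?case using Nil.prems by simp
next
  case (Cons y b)
  have IH: "(chain_weight ((x + y) # b @ \<alpha>) (j # replicate (length b) j @ is) :: 'a) =
    of_nat (prod_list ((x + y) # b)) / of_nat (pi_comp ((x + y) # b)) * chain_weight \<alpha> is"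
    using Cons by simp
  have nz: "(of_nat (x + y) :: 'a) \<noteq> 0" "(of_nat x :: 'a) \<noteq> 0"
    "(of_nat (pi_comp ((x + y) # b)) :: 'a) \<noteq> 0"
    using Cons.prems pi_comp_pos[of "x + y" b] by (auto simp del: of_nat_add)
  have "(chain_weight (x # (y # b) @ \<alpha>) (j # replicate (length (y # b)) j @ is) :: 'a) =
    of_nat y / of_nat (x + y) *
      (of_nat (prod_list ((x + y) # b)) / of_nat (pi_comp ((x + y) # b)) * chain_weight \<alpha> is)"
    using IH by (simp del: of_nat_add prod_list.Cons)
  also have "\<dots> = of_nat (prod_list (x # y # b)) / of_nat (pi_comp (x # y # b)) * chain_weight \<alpha> is"
    unfolding pi_comp_Cons2 using nz by (simp add: divide_simps mult_ac del: of_nat_add)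
  finally show ?case .
qed

text \<open>Neighbouring blocks carry different indices, so the weight factors over the blocks and
  depends on the coarsening alone, not on \<open>js\<close>.\<close>

lemma chain_weight_spread:
  assumes "length bs = length js" "[] \<notin> set bs" "sorted_wrt (<) js" "0 \<notin> set (concat bs)"
  shows "(chain_weight (concat bs) (spread bs js) :: 'a::field_char_0) =
    of_nat (prod_list (concat bs)) / of_nat (prod_list (map pi_comp bs))"
  using assms
proof (induction bs js rule: list_induct2)
  case (Cons b bs j js)
  then obtain x b' where b: "b = x # b'" by (cases b) auto
  have "j \<notin> set (spread bs js)" using Cons by (auto simp: set_spread)
  then have "(chain_weight (x # b' @ concat bs) (j # replicate (length b') j @ spread bs js) :: 'a) =
    of_nat (prod_list (x # b')) / of_nat (pi_comp (x # b')) * chain_weight (concat bs) (spread bs js)"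
    using Cons b by (intro chain_weight_block) (auto simp: length_spread)
  then show ?case using Cons b by (simp add: mult_ac)
qed simp

section \<open>Comparison of coefficients\<close>

lemma prod_power_count_list:
  assumes "finite S" "set \<alpha> \<subseteq> S"
  shows "(\<Prod>i\<in>S. i ^ count_list \<alpha> i) = (prod_list \<alpha> :: nat)"
  using assms(2)
proof (induction \<alpha>)
  case (Cons a \<alpha>)
  have "(\<Prod>i\<in>S. i ^ count_list (a # \<alpha>) i) = (\<Prod>i\<in>S. (if i = a then i else 1) * i ^ count_list \<alpha> i)"
    by (intro prod.cong) auto
  also have "\<dots> = (\<Prod>i\<in>S. if i = a then i else 1) * (\<Prod>i\<in>S. i ^ count_list \<alpha> i)"
    by (rule prod.distrib)
  also have "\<dots> = a * prod_list \<alpha>"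
    using Cons assms(1) by (simp)
  finally show ?case by simp
qed simp

text \<open>Separates the product of the parts, which the chain weights absorb, from the factorials
  that survive in the theorem.\<close>

lemma of_nat_z_comp:
  assumes "composition n \<alpha>"
  shows "(of_nat (z_comp \<alpha>) :: 'a::field_char_0) =
    of_nat (prod_list \<alpha>) * (\<Prod>i=1..n. fact (count_list \<alpha> i))"
proof -
  have "set \<alpha> \<subseteq> {1..n}"
  proof
    fix a assume "a \<in> set \<alpha>"
    moreover from this have "a \<noteq> 0" using assms by (metis composition_def)
    ultimately show "a \<in> {1..n}"
      using assms member_le_sum_list[of a \<alpha>] by (auto simp: composition_def)
  qed
  then have "(\<Prod>i=1..n. i ^ count_list \<alpha> i) = prod_list \<alpha>"
    by (intro prod_power_count_list) auto
  then have "z_comp \<alpha> = prod_list \<alpha> * (\<Prod>i=1..n. fact (count_list \<alpha> i))"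
    using assms by (simp add: z_comp_def composition_def prod.distrib)
  then show ?thesis by simp
qed

text \<open>Each index used occurs in \<open>e\<close>, so only sequences within
  \<open>{1..m}\<close> contribute and the count becomes a finite sum of indicators.\<close>

lemma monomial_qsym_eq:
  assumes "0 \<notin> set \<beta>" "Poly_Mapping.keys e \<subseteq> {1..m}"
  shows "(monomial_qsym \<beta> e :: 'a::comm_semiring_1) =
    (\<Sum>js\<in>increasing_seqs m (length \<beta>). 1 when exponents js \<beta> = e)"
proof -
  have "{is. length is = length \<beta> \<and> 0 \<notin> set is \<and> sorted_wrt (<) is
     \<and> (monom is \<beta> :: 'a mpoly) = Poly_Mapping.single e 1} =
     {js \<in> increasing_seqs m (length \<beta>). exponents js \<beta> = e}"
    (is "?L = ?R")
  proof (intro equalityI subsetI)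
    fix js assume js: "js \<in> ?L"
    then have "length js = length \<beta>" "exponents js \<beta> = e"
      by (auto simp: monom_eq_single_iff)
    then have "set js \<subseteq> {1..m}" using keys_exponents[of js \<beta>] assms by simp
    then show "js \<in> ?R" using js by (auto simp: increasing_seqs_def monom_eq_single_iff)
  qed (auto simp: increasing_seqs_def monom_eq_single_iff)
  then show ?thesis
    unfolding monomial_qsym_def when_def
    by (simp add: finite_increasing_seqs sum.If_cases Int_def)
qed

text \<open>Coefficient of the left-hand side of the theorem: the double sum over coarsenings and
  strictly increasing sequences collapses, through \<open>spread\<close>, to one sum over weakly
  increasing sequences.\<close>

lemma specialize_Psi:
  assumes "composition n \<alpha>"
  shows "specialize m (Psi \<alpha> :: 'a::field_char_0 series) e =
    (\<Prod>i=1..n. fact (count_list \<alpha> i)) *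
    (\<Sum>is\<in>weak_seqs m (length \<alpha>). chain_weight \<alpha> is when exponents is \<alpha> = e)"
proof (cases "Poly_Mapping.keys e \<subseteq> {1..m}")
  case True
  have nz: "0 \<notin> set \<alpha>" using assms by (simp add: composition_def)
  \<comment> \<open>A nonempty block of positive parts has positive sum.\<close>
  have nz': "0 \<notin> set (map sum_list bs)" if "bs \<in> block_splits \<alpha>" for bs
  proof
    assume "0 \<in> set (map sum_list bs)"
    then obtain b where "b \<in> set bs" "sum_list b = 0" by auto
    moreover from this that have "b \<noteq> []" by (auto simp: block_splits_def)
    ultimately have "hd b \<in> set (concat bs)" "hd b = 0" by (auto intro!: bexI[of _ b])
    with that nz show False by (simp add: block_splits_def)
  qed
  let ?z = "of_nat (prod_list \<alpha>) :: 'a"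
  have "?z * (\<Sum>\<beta> | \<alpha> \<preccurlyeq> \<beta>. 1 / of_nat (pi_ref \<alpha> \<beta>) * monomial_qsym \<beta> e) =
    ?z * (\<Sum>bs\<in>block_splits \<alpha>. 1 / of_nat (pi_ref \<alpha> (map sum_list bs)) *
      monomial_qsym (map sum_list bs) e)"
    by (simp add: sum.reindex_bij_betw[OF coarsenings_bij[OF nz], symmetric])
  also have "\<dots> = (\<Sum>bs\<in>block_splits \<alpha>. \<Sum>js\<in>increasing_seqs m (length bs).
      ?z / of_nat (pi_ref \<alpha> (map sum_list bs)) * (1 when exponents js (map sum_list bs) = e))"
    unfolding sum_distrib_left
    by (intro sum.cong refl) (simp add: monomial_qsym_eq[OF nz' True] sum_distrib_left sum_divide_distrib)
  also have "\<dots> = (\<Sum>bs\<in>block_splits \<alpha>. \<Sum>js\<in>increasing_seqs m (length bs).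
      chain_weight \<alpha> (spread bs js) when exponents (spread bs js) \<alpha> = e)"
  proof (intro sum.cong refl)
    fix bs js assume *: "bs \<in> block_splits \<alpha>" "js \<in> increasing_seqs m (length bs)"
    then have "length bs = length js" "[] \<notin> set bs" "sorted_wrt (<) js" "concat bs = \<alpha>"
      by (auto simp: block_splits_def increasing_seqs_def)
    then show "?z / of_nat (pi_ref \<alpha> (map sum_list bs)) *
        (1 when exponents js (map sum_list bs) = e) =
      (chain_weight \<alpha> (spread bs js) when exponents (spread bs js) \<alpha> = e)"
      using chain_weight_spread[of bs js, where 'a = 'a] exponents_spread[of bs js] nz
      by (simp add: pi_ref_eq[OF nz *(1)] when_def)
  qed
  also have "\<dots> = (\<Sum>(bs, js)\<in>(SIGMA bs:block_splits \<alpha>. increasing_seqs m (length bs)).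
      chain_weight \<alpha> (spread bs js) when exponents (spread bs js) \<alpha> = e)"
    by (rule sum.Sigma) (simp_all add: finite_block_splits finite_increasing_seqs)
  also have "\<dots> = (\<Sum>is\<in>weak_seqs m (length \<alpha>). chain_weight \<alpha> is when exponents is \<alpha> = e)"
    by (simp add: sum.reindex_bij_betw[OF spread_bij, symmetric] case_prod_unfold)
  finally show ?thesis
    using True by (simp add: specialize_def Psi_def of_nat_z_comp[OF assms] mult_ac)
next
  case False
  \<comment> \<open>If \<open>e\<close> involves a variable outside \<open>{1..m}\<close>, no
    sequence yields it and both sides vanish.\<close>
  have "exponents is \<alpha> \<noteq> e" if "is \<in> weak_seqs m (length \<alpha>)" for "is"
    using that False keys_exponents[of "is" \<alpha>] assms by (auto simp: weak_seqs_def composition_def)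
  then show ?thesis using False by (simp add: specialize_def when_def)
qed

text \<open>For a fixed weakly increasing sequence only the condition on the maxima remains, and
  \<open>one_line\<close> turns the count of permutations into one of words.\<close>

lemma card_index_seqs:
  assumes "composition n \<alpha>" "is \<in> weak_seqs m (length \<alpha>)"
  shows "of_nat (card {\<sigma>. \<sigma> permutes {1..n} \<and> is \<in> index_seqs \<alpha> m (one_line n \<sigma>)}) =
    (fact n * chain_weight \<alpha> is :: 'a::field_char_0)"
proof -
  let ?W = "{w \<in> permutations_of_set {1..n}. increasing_maxima \<alpha> is w}"
  have "bij_betw (one_line n) {\<sigma> \<in> {\<sigma>. \<sigma> permutes {1..n}}. increasing_maxima \<alpha> is (one_line n \<sigma>)} ?W"
    by (rule bij_betw_subset[OF one_line_bij]) (use one_line_bij[of n] in \<open>auto simp: bij_betw_def\<close>)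
  moreover have "{\<sigma> \<in> {\<sigma>. \<sigma> permutes {1..n}}. increasing_maxima \<alpha> is (one_line n \<sigma>)} =
      {\<sigma>. \<sigma> permutes {1..n} \<and> is \<in> index_seqs \<alpha> m (one_line n \<sigma>)}"
    using assms(2) by (auto simp: index_seqs_def weak_seqs_def increasing_maxima_def)
  ultimately have "card {\<sigma>. \<sigma> permutes {1..n} \<and> is \<in> index_seqs \<alpha> m (one_line n \<sigma>)} = card ?W"
    by (simp only: bij_betw_same_card)
  moreover have "of_nat (card ?W) = fact (card {1..n}) * (chain_weight \<alpha> is :: 'a)"
    using assms by (intro card_increasing_maxima) (auto simp: composition_def weak_seqs_def)
  ultimately show ?thesis by simp
qed

theorem theorem3p12:
  fixes \<alpha> :: "nat list" and n m :: nat
  assumes "composition n \<alpha>" and "m \<ge> 1"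
  shows "specialize m (Psi \<alpha> :: 'a::field_char_0 series) =
    Poly_Mapping.lookup
      (const ((\<Prod>i=1..n. fact (count_list \<alpha> i)) / fact n) *
       (\<Sum>\<sigma> | \<sigma> permutes {1..n}. \<Sum>is\<in>index_seqs \<alpha> m (one_line n \<sigma>). monom is \<alpha>))"
proof
  fix e :: expvec
  let ?c = "(\<Prod>i=1..n. fact (count_list \<alpha> i)) :: 'a"
  let ?W = "weak_seqs m (length \<alpha>)"
  let ?P = "{\<sigma>. \<sigma> permutes {1..n}}"
  have lookup_const: "Poly_Mapping.lookup (const c * p) e = c * Poly_Mapping.lookup p e"
    for c :: 'a and p
    by (simp add: const_def mult_map_scale_conv_mult[symmetric] Poly_Mapping.map.rep_eq when_def)
  have fin: "finite ?P" by (rule finite_permutations) simp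
  \<comment> \<open>Writes the index set, which varies with the permutation, as a filter on a fixed
    finite set, so that the two sums can be exchanged.\<close>
  have index_W: "index_seqs \<alpha> m w = {is \<in> ?W. is \<in> index_seqs \<alpha> m w}" for w
    by (auto simp: index_seqs_def weak_seqs_def)
  have "Poly_Mapping.lookup (\<Sum>\<sigma>\<in>?P. \<Sum>is\<in>index_seqs \<alpha> m (one_line n \<sigma>). monom is \<alpha>) e =
    (\<Sum>\<sigma>\<in>?P. \<Sum>is\<in>index_seqs \<alpha> m (one_line n \<sigma>). (1 when exponents is \<alpha> = e) :: 'a)"
    unfolding lookup_sum
    by (intro sum.cong refl) (simp add: index_seqs_def monom_eq_single lookup_single)
  also have "\<dots> = (\<Sum>\<sigma>\<in>?P. \<Sum>is | is \<in> ?W \<and> is \<in> index_seqs \<alpha> m (one_line n \<sigma>).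
      1 when exponents is \<alpha> = e)"
    using index_W by simp
  also have "\<dots> = (\<Sum>is\<in>?W. \<Sum>\<sigma> | \<sigma> \<in> ?P \<and> is \<in> index_seqs \<alpha> m (one_line n \<sigma>).
      1 when exponents is \<alpha> = e)"
    by (rule sum.swap_restrict[OF fin finite_weak_seqs])
  \<comment> \<open>The inner sum is constant in the permutation and hence a count; its factor
    \<open>fact n\<close> later cancels the denominator of the theorem.\<close>
  also have "\<dots> = (\<Sum>is\<in>?W. fact n * (chain_weight \<alpha> is when exponents is \<alpha> = e))"
    using card_index_seqs[OF assms(1), where 'a = 'a]
    by (intro sum.cong refl) (simp add: when_def)
  also have "\<dots> = fact n * (\<Sum>is\<in>?W. chain_weight \<alpha> is when exponents is \<alpha> = e)"
    by (simp add: sum_distrib_left)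
  finally show "specialize m (Psi \<alpha> :: 'a series) e =
    Poly_Mapping.lookup
      (const (?c / fact n) *
       (\<Sum>\<sigma>\<in>?P. \<Sum>is\<in>index_seqs \<alpha> m (one_line n \<sigma>). monom is \<alpha>)) e"
    by (simp add: lookup_const specialize_Psi[OF assms(1)])
qed

end
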